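(* Let $x\in(0,1)$ and let $f(z)=\sum_{m=0}^\infty f_m z^m$ with $|f_m|\le1$ for all $m\ge0$. If $n$ is an integer with $n\ge n_0(x)$, then \[ |r_n(f;z)|\le \frac{|z|^{2n+1}}{x-|z|}\cdot\frac{2x}{(1-x)^{2n+2}}\cdot\frac{(n!)^2}{((2n)!)^2}\qquad\text{for all } |z|<x. \] Moreover this is sharp in order in $n$: for $g(z)=z/(1-z)=\sum_{m\ge1}z^m$ (which satisfies the hypothesis) and every $n\ge n_0(x)$, \[ \max_{|z|=x}|r_n(g;z)|\ge \frac{x^{2n+1}}{(1-x)^{2n+2}}\cdot\frac{(n!)^2}{((2n)!)^2}. \] In particular, if $n\ge13$ and $x_n=\sqrt n/(1+\sqrt n)$, then \[ |r_n(f;z)|\le \frac{|z|^{2n+1}}{x_n-|z|}\cdot\frac{0.92^{2n}}{n^{\,n-1}}\qquad\text{for all } |z|<x_n. \]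
   Context: For $n\ge1$ let $y_n(z)=\sum_{k=0}^{n}\frac{(n+k)!}{(n-k)!\,k!}\left(\frac{z}{2}\right)^k$ be the $n$-th Bessel polynomial and let $\alpha_{n1},\dots,\alpha_{nn}$ be its zeros (they are simple). Put $a_{nk}=1-\alpha_{nk}/2$ and $b_{nk}=1+\alpha_{nk}/2$ for $k=1,\dots,n$. For $f$ analytic where needed define $r_n(f;z)=zf'(z)-\sum_{k=1}^n\big(f(a_{nk}z)-f(b_{nk}z)\big)$. For $x\in(0,1)$ put $n_0(x)=\max\{14,\;x^2(1-x)^{-2}\}-1$. *)

theory Defs
  imports "HOL-Analysis.Analysis" "HOL-Computational_Algebra.Polynomial"
begin

definition bessel_poly :: "nat \<Rightarrow> complex poly" where
  "bessel_poly n = (\<Sum>k\<le>n. monom (fact (n + k) / (fact (n - k) * fact k) / 2 ^ k) k)"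

text \<open>Zeros of y_n (they are simple, so summing over the zero set is summing over k=1..n).\<close>
definition bessel_zeros :: "nat \<Rightarrow> complex set" where
  "bessel_zeros n = {\<alpha>. poly (bessel_poly n) \<alpha> = 0}"

definition rn :: "nat \<Rightarrow> (complex \<Rightarrow> complex) \<Rightarrow> complex \<Rightarrow> complex" where
  "rn n f z = z * deriv f z
     - (\<Sum>\<alpha>\<in>bessel_zeros n. f ((1 - \<alpha> / 2) * z) - f ((1 + \<alpha> / 2) * z))"

definition n0 :: "real \<Rightarrow> real" where
  "n0 x = max 14 (x\<^sup>2 / (1 - x)\<^sup>2) - 1"

definition pseries :: "(nat \<Rightarrow> complex) \<Rightarrow> complex \<Rightarrow> complex" where
  "pseries c z = (\<Sum>m. c m * z ^ m)"

end

theory Submission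
  imports Defs "HOL-Complex_Analysis.Cauchy_Integral_Formula"
    "HOL-Computational_Algebra.Fundamental_Theorem_Algebra"
begin

text \<open>
  Let \<open>\<theta>(s) = s\<^sup>n y\<^sub>n(1/s)\<close> be the reverse Bessel polynomial and \<open>q(s) = \<theta>(s) \<theta>(-s)\<close>. The functions
  \<open>\<theta>(s) e\<^sup>-\<^sup>s\<close> and \<open>\<theta>(-s) e\<^sup>s\<close> solve the same second order linear equation, and their Wronskian
  is a multiple of \<open>s\<^sup>2\<^sup>n\<close>. Hence the zeros are simple and
  \<open>\<theta>'(s)/\<theta>(s) + \<theta>'(-s)/\<theta>(-s) = 2 - 2 (-1)\<^sup>n s\<^sup>2\<^sup>n / q(s)\<close>. Writing both logarithmic derivatives as
  partial fractions gives, for \<open>g(z) = z/(1-z)\<close> and \<open>s = z/(2(1-z))\<close>, the closed form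
  \<open>r\<^sub>n(g; z) = 2 (-1)\<^sup>n s\<^sup>2\<^sup>n\<^sup>+\<^sup>1 / ((1-z) q(s))\<close>.

  The product \<open>q\<close> of two solutions satisfies a third order equation, which yields a two-term
  recurrence for its coefficients. These alternate in sign and decay so fast that
  \<open>|q(s)| \<ge> q(0)/2\<close> for \<open>4|s|\<^sup>2 \<le> n + 1\<close>, while \<open>|q(s)| \<le> q(0)\<close> for such real \<open>s\<close>. The second estimate
  at \<open>z = x\<close> is the lower bound. The first one and Cauchy's inequality for \<open>r\<^sub>n(g; z) / z\<^sup>2\<^sup>n\<^sup>+\<^sup>1\<close> on
  \<open>|z| \<le> x\<close> bound the numbers \<open>R\<^sub>m\<close> with \<open>r\<^sub>n(z\<^sup>m; z) = R\<^sub>m z\<^sup>m\<close>, and the upper bound follows by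
  summing \<open>f\<^sub>m R\<^sub>m z\<^sup>m\<close>.
\<close>

subsection \<open>The reverse Bessel polynomials\<close>

lemma coeff_bessel_poly:
  "coeff (bessel_poly n) k = (if k \<le> n then fact (n + k) / (fact (n - k) * fact k) / 2 ^ k else 0)"
  by (simp add: bessel_poly_def coeff_sum)

lemma degree_bessel_poly: "degree (bessel_poly n) = n"
proof (rule antisym)
  show "degree (bessel_poly n) \<le> n" by (rule degree_le) (simp add: coeff_bessel_poly)
  show "n \<le> degree (bessel_poly n)" by (rule le_degree) (simp add: coeff_bessel_poly)
qed

definition bessel_theta :: "nat \<Rightarrow> complex poly" where
  "bessel_theta n = reflect_poly (bessel_poly n)"

lemma coeff_bessel_theta:
  "coeff (bessel_theta n) j =
     (if j \<le> n then fact (2 * n - j) / (fact j * fact (n - j)) / 2 ^ (n - j) else 0)"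
proof -
  have "n + (n - j) = 2 * n - j" if "j \<le> n" using that by simp
  then show ?thesis
    by (auto simp: bessel_theta_def coeff_reflect_poly degree_bessel_poly coeff_bessel_poly)
qed

text \<open>The ratio of consecutive coefficients, cleared of denominators so that it holds for
  every \<open>j\<close>: at \<open>j = n\<close> both sides vanish, and beyond that both
  coefficients do.\<close>

lemma coeff_bessel_theta_Suc:
  "of_nat (Suc j) * (2 * of_nat n - of_nat j) * coeff (bessel_theta n) (Suc j)
   = 2 * (of_nat n - of_nat j) * coeff (bessel_theta n) j"
proof (cases "j < n")
  case True
  then obtain d where n: "n = j + Suc d" by (metis less_iff_Suc_add add_Suc_right)
  have "2 * n - j = Suc (j + 2 * d + 1)" "2 * n - Suc j = j + 2 * d + 1"
    "n - j = Suc d" "n - Suc j = d" using n by auto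
  moreover have "1 + of_nat j \<noteq> (0::complex)" "1 + of_nat d \<noteq> (0::complex)"
    using of_nat_neq_0[of j, where 'a = complex] of_nat_neq_0[of d, where 'a = complex] by simp_all
  ultimately show ?thesis
    unfolding coeff_bessel_theta using True n
    by (simp add: divide_simps) (simp add: algebra_simps)
qed (auto simp: coeff_bessel_theta)

text \<open>Comparing coefficients of \<open>s^j\<close> gives exactly the recurrence above. For
  \<open>y = theta(s) exp(-s)\<close> the equation reads
  \<open>s y'' - 2n y' - s y = 0\<close>.\<close>

lemma bessel_theta_ode:
  "[:0, 1:] * pderiv (pderiv (bessel_theta n))
   = 2 * ([:0, 1:] + of_nat n) * pderiv (bessel_theta n) - 2 * of_nat n * bessel_theta n"
proof (rule poly_eqI)
  fix j
  have of_nat_poly': "of_nat n * p = smult (of_nat n) p" for p :: "complex poly"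
    by (simp add: of_nat_poly)
  have two: "2 * p = smult 2 p" for p :: "complex poly"
    by (metis smult_1_left smult_add_left mult_2 one_add_one)
  show "coeff ([:0, 1:] * pderiv (pderiv (bessel_theta n))) j
      = coeff (2 * ([:0, 1:] + of_nat n) * pderiv (bessel_theta n) - 2 * of_nat n * bessel_theta n) j"
    using coeff_bessel_theta_Suc[of j n]
    by (cases j) (simp_all add: coeff_pderiv of_nat_poly' two distrib_left distrib_right mult.assoc,
        (simp_all add: algebra_simps)?)
qed

section \<open>The reflected polynomial and the Wronskian\<close>

definition bessel_theta_neg :: "nat \<Rightarrow> complex poly" where
  "bessel_theta_neg n = pcompose (bessel_theta n) [:0, -1:]"

lemma pderiv_bessel_theta_neg:
  "pderiv (bessel_theta_neg n) = - pcompose (pderiv (bessel_theta n)) [:0, -1:]"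
  "pderiv (pderiv (bessel_theta_neg n)) = pcompose (pderiv (pderiv (bessel_theta n))) [:0, -1:]"
  by (simp_all add: bessel_theta_neg_def pderiv_pcompose pderiv_minus pderiv_pCons)

text \<open>The substitution \<open>s -> -s\<close> in the equation for \<open>bessel_theta\<close>.
  The equation for \<open>y\<close> is invariant under it, so \<open>theta(-s) exp(s)\<close> is a
  second solution.\<close>

lemma bessel_theta_neg_ode:
  "[:0, 1:] * pderiv (pderiv (bessel_theta_neg n))
   = 2 * (of_nat n - [:0, 1:]) * pderiv (bessel_theta_neg n) + 2 * of_nat n * bessel_theta_neg n"
proof -
  define X where "X = [:0, 1 :: complex:]"
  have X: "pcompose X [:0, -1:] = - X" "pcompose 2 [:0, -1:] = (2 :: complex poly)"
    "pcompose (of_nat n) [:0, -1:] = (of_nat n :: complex poly)"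
    by (simp_all add: X_def pcompose_pCons of_nat_poly numeral_poly)
  have "pcompose (X * pderiv (pderiv (bessel_theta n))) [:0, -1:] =
    pcompose (2 * (X + of_nat n) * pderiv (bessel_theta n) - 2 * of_nat n * bessel_theta n) [:0, -1:]"
    by (simp only: X_def bessel_theta_ode)
  then have "- X * pderiv (pderiv (bessel_theta_neg n))
      = 2 * (- X + of_nat n) * (- pderiv (bessel_theta_neg n)) - 2 * of_nat n * bessel_theta_neg n"
    unfolding pderiv_bessel_theta_neg(2) unfolding pderiv_bessel_theta_neg(1) unfolding bessel_theta_neg_def
    by (simp add: pcompose_mult pcompose_add pcompose_diff X)
  then show ?thesis unfolding X_def[symmetric] by (simp add: algebra_simps)
qed

lemma degree_bessel_theta: "degree (bessel_theta n) = n"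
  by (simp add: bessel_theta_def degree_reflect_poly_eq degree_bessel_poly coeff_bessel_poly poly_0_coeff_0)

lemma lead_coeff_bessel_theta: "coeff (bessel_theta n) n = 1"
  by (simp add: coeff_bessel_theta)

lemma degree_bessel_theta_neg: "degree (bessel_theta_neg n) = n"
  by (simp add: bessel_theta_neg_def degree_bessel_theta degree_pcompose)

lemma lead_coeff_bessel_theta_neg: "coeff (bessel_theta_neg n) n = (-1) ^ n"
  using lead_coeff_comp[of "[:0, -1:]" "bessel_theta n"] lead_coeff_bessel_theta[of n]
  by (simp add: degree_bessel_theta degree_bessel_theta_neg flip: bessel_theta_neg_def)

text \<open>The left side is the Wronskian \<open>W\<close> of the two solutions, the exponentials
  having cancelled. The equations give \<open>s W' = 2n W\<close>, so \<open>W\<close> is a multiple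
  of \<open>s^(2n)\<close>, and the constant is read off from the leading coefficients.\<close>

lemma bessel_theta_wronskian:
  assumes "n \<ge> 1"
  shows "pderiv (bessel_theta n) * bessel_theta_neg n - bessel_theta n * pderiv (bessel_theta_neg n)
           - 2 * (bessel_theta n * bessel_theta_neg n) = monom (2 * (-1) ^ Suc n) (2 * n)"
    (is "?W = _")
proof -
  define u v X N where "u = bessel_theta n" and "v = bessel_theta_neg n"
    and "X = [:0, 1::complex:]" and "N = (of_nat n :: complex poly)"
  have u: "X * pderiv (pderiv u) = 2 * (X + N) * pderiv u - 2 * N * u"
    and v: "X * pderiv (pderiv v) = 2 * (N - X) * pderiv v + 2 * N * v"
    using bessel_theta_ode[of n] bessel_theta_neg_ode[of n] by (simp_all only: u_def v_def X_def N_def)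
  have "pderiv (2 :: complex poly) = 0" by (metis pderiv_of_nat of_nat_numeral)
  then have "X * pderiv (pderiv u * v - u * pderiv v - 2 * (u * v))
      = (X * pderiv (pderiv u)) * v - u * (X * pderiv (pderiv v)) - 2 * X * (pderiv u * v + u * pderiv v)"
    by (simp add: pderiv_mult pderiv_diff pderiv_add algebra_simps)
  also have "\<dots> = 2 * N * (pderiv u * v - u * pderiv v - 2 * (u * v))"
    unfolding u v by (simp add: algebra_simps)
  finally have XW: "[:0, 1:] * pderiv ?W = 2 * of_nat n * ?W"
    unfolding u_def v_def X_def N_def .
  \<comment> \<open>The operator \<open>s d/ds\<close> multiplies the \<open>j\<close>-th
    coefficient by \<open>j\<close>, so only \<open>j = 2n\<close> survives.\<close>
  have "coeff ?W j = 0" if "j \<noteq> 2 * n" for j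
  proof -
    have "of_nat j * coeff ?W j = 2 * of_nat n * coeff ?W j"
    proof -
      have "coeff ([:0, 1:] * pderiv ?W) j = of_nat j * coeff ?W j"
        by (cases j) (simp_all add: coeff_pderiv)
      moreover have "2 * of_nat n * ?W = smult (2 * of_nat n) ?W"
        by (simp add: of_nat_poly mult.commute[of _ 2] mult.assoc numeral_mult_conv_smult)
      ultimately show ?thesis using XW by (metis coeff_smult)
    qed
    then have "(of_nat j - of_nat (2 * n) :: complex) * coeff ?W j = 0" by (simp add: algebra_simps)
    then show ?thesis using that by (simp del: of_nat_mult)
  qed
  \<comment> \<open>The terms with a derivative have degree below \<open>2n\<close>; only
    \<open>-2 u v\<close> contributes.\<close>
  moreover have "coeff ?W (2 * n) = 2 * (-1) ^ Suc n"
  proof -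
    have d: "degree (pderiv (bessel_theta n)) < n" "degree (pderiv (bessel_theta_neg n)) < n"
      using assms by (simp_all add: degree_pderiv degree_bessel_theta degree_bessel_theta_neg)
    have 1: "coeff (pderiv (bessel_theta n) * bessel_theta_neg n) (2 * n) = 0"
      using degree_mult_le[of "pderiv (bessel_theta n)" "bessel_theta_neg n"] d
      by (intro coeff_eq_0) (simp add: degree_bessel_theta_neg)
    have 2: "coeff (bessel_theta n * pderiv (bessel_theta_neg n)) (2 * n) = 0"
      using degree_mult_le[of "bessel_theta n" "pderiv (bessel_theta_neg n)"] d
      by (intro coeff_eq_0) (simp add: degree_bessel_theta)
    have "coeff (bessel_theta n * bessel_theta_neg n) (2 * n) = (-1) ^ n"
      using coeff_mult_degree_sum[of "bessel_theta n" "bessel_theta_neg n"]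
      by (simp add: degree_bessel_theta degree_bessel_theta_neg lead_coeff_bessel_theta
          lead_coeff_bessel_theta_neg mult_2)
    then show ?thesis by (simp add: 1 2 numeral_mult_conv_smult)
  qed
  ultimately show ?thesis by (intro poly_eqI) auto
qed

subsection \<open>The product of the two solutions\<close>

definition bessel_q :: "nat \<Rightarrow> complex poly" where
  "bessel_q n = bessel_theta n * bessel_theta_neg n"

text \<open>Multiplied by \<open>exp(-s)\<close> and \<open>exp(s)\<close>, the two factors of
  \<open>q\<close> solve one second order equation, so \<open>q\<close> solves its symmetric square,
  which has order three. The powers of \<open>X\<close> clear the denominators.\<close>

lemma bessel_q_ode:
  fixes n :: nat
  defines "X \<equiv> [:0, 1::complex:]" and "N \<equiv> of_nat n" and "q \<equiv> bessel_q n"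
  shows "X * (X * pderiv (pderiv (pderiv q))) - 6 * N * X * pderiv (pderiv q)
    + (2 * N + 8 * N * N) * pderiv q = 4 * X * (X * pderiv q) - 8 * N * (X * q)"
proof -
  define u v where "u = bessel_theta n" and "v = bessel_theta_neg n"
  have u: "X * pderiv (pderiv u) = 2 * (X + N) * pderiv u - 2 * N * u"
    and v: "X * pderiv (pderiv v) = 2 * (N - X) * pderiv v + 2 * N * v"
    using bessel_theta_ode[of n] bessel_theta_neg_ode[of n] by (simp_all only: u_def v_def X_def N_def)
  have X': "pderiv X = 1" and N': "pderiv N = 0" "pderiv 2 = (0 :: complex poly)"
    by (simp_all add: X_def N_def pderiv_pCons of_nat_poly)
  have "X * pderiv (pderiv (pderiv u)) = 2 * pderiv u + 2 * (X + N) * pderiv (pderiv u) - 2 * N * pderiv u - pderiv (pderiv u)"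
    using arg_cong[OF u, of pderiv]
    by (simp add: pderiv_mult pderiv_diff pderiv_add X' N' algebra_simps)
  then have u3': "X * (X * pderiv (pderiv (pderiv u))) = X * (2 * pderiv u + 2 * (X + N) * pderiv (pderiv u) - 2 * N * pderiv u - pderiv (pderiv u))"
    by (simp only:)
  \<comment> \<open>The differentiated equation, multiplied by \<open>X\<close>, expresses the third
    derivative through \<open>X u''\<close> and \<open>X u'\<close>; the second derivatives that
    remain are then removed by the original equation.\<close>
  have u3: "X * (X * pderiv (pderiv (pderiv u)))
      = (2 * X + 2 * N - 1) * (X * pderiv (pderiv u)) + (2 - 2 * N) * X * pderiv u"
    unfolding u3' by (simp add: algebra_simps)
  have "X * pderiv (pderiv (pderiv v)) = 2 * (N - X) * pderiv (pderiv v) - 2 * pderiv v + 2 * N * pderiv v - pderiv (pderiv v)"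
    using arg_cong[OF v, of pderiv]
    by (simp add: pderiv_mult pderiv_diff pderiv_add X' N' algebra_simps)
  then have v3': "X * (X * pderiv (pderiv (pderiv v))) = X * (2 * (N - X) * pderiv (pderiv v) - 2 * pderiv v + 2 * N * pderiv v - pderiv (pderiv v))"
    by (simp only:)
  have v3: "X * (X * pderiv (pderiv (pderiv v)))
      = (2 * N - 2 * X - 1) * (X * pderiv (pderiv v)) + (2 * N - 2) * X * pderiv v"
    unfolding v3' by (simp add: algebra_simps)
  have "X * (X * pderiv (pderiv (pderiv (u * v)))) - 6 * N * X * pderiv (pderiv (u * v))
      + (2 * N + 8 * N * N) * pderiv (u * v)
    = v * (X * (X * pderiv (pderiv (pderiv u)))) + u * (X * (X * pderiv (pderiv (pderiv v))))
      + 3 * X * pderiv v * (X * pderiv (pderiv u)) + 3 * X * pderiv u * (X * pderiv (pderiv v))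
      - 6 * N * (v * (X * pderiv (pderiv u)) + u * (X * pderiv (pderiv v)) + 2 * X * pderiv u * pderiv v)
      + (2 * N + 8 * N * N) * (pderiv u * v + u * pderiv v)"
    unfolding pderiv_mult pderiv_add by (simp add: algebra_simps)
  also have "\<dots> = 4 * X * (X * pderiv (u * v)) - 8 * N * (X * (u * v))"
    unfolding u3 v3 unfolding u v pderiv_mult by (simp add: algebra_simps)
  finally show ?thesis
    unfolding q_def bessel_q_def u_def[symmetric] v_def[symmetric] .
qed

section \<open>Recurrence and decay of the coefficients of \<open>q\<close>\<close>

lemma coeff_bessel_q_step:
  "of_nat (m + 2) * (of_nat m + 1 - 2 * of_nat n) * (of_nat m - 4 * of_nat n) * coeff (bessel_q n) (m + 2)
   = 4 * (of_nat m - 2 * of_nat n) * coeff (bessel_q n) m"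
proof -
  have c: "of_nat k * p = smult (of_nat k) p" "numeral w * p = smult (numeral w) p" for k w and p :: "complex poly"
    by (simp_all add: of_nat_poly numeral_poly)
  \<comment> \<open>This is the coefficient of \<open>s^(m+1)\<close>; the bracket factors as
    \<open>(m + 1 - 2n) (m - 4n)\<close>.\<close>
  let ?L = "of_nat (m + 2) * (of_nat m * (of_nat m + 1) - 6 * of_nat n * (of_nat m + 1)
    + (2 * of_nat n + 8 * of_nat n * of_nat n)) * coeff (bessel_q n) (m + 2)"
  have "?L = 4 * of_nat m * coeff (bessel_q n) m - 8 * of_nat n * coeff (bessel_q n) m"
    using arg_cong[OF bessel_q_ode[of n], of "\<lambda>p. coeff p (Suc m)"]
    by (cases m) (simp_all add: coeff_pderiv c mult.assoc distrib_right, simp_all add: algebra_simps)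
  then show ?thesis by (simp add: algebra_simps)
qed

text \<open>The constant term of the equation forces coefficient 1 to vanish. The recurrence
  propagates this zero while \<open>m + 1 - 2n\<close> is nonzero, that is for odd
  \<open>m < 2n - 1\<close>; the factor \<open>m - 4n\<close> is odd and never vanishes.\<close>

lemma coeff_bessel_q_odd:
  assumes "k < n"
  shows "coeff (bessel_q n) (2 * k + 1) = 0"
  using assms
proof (induction k)
  case 0
  have c: "of_nat k * p = smult (of_nat k) p" "numeral w * p = smult (numeral w) p" for k w and p :: "complex poly"
    by (simp_all add: of_nat_poly numeral_poly)
  have "(2 * of_nat n + 8 * of_nat n * of_nat n) * coeff (bessel_q n) 1 = 0"
    using arg_cong[OF bessel_q_ode[of n], of "\<lambda>p. coeff p 0"]
    by (simp add: coeff_pderiv c mult.assoc distrib_right)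
  moreover have "(2 * of_nat n + 8 * of_nat n * of_nat n :: complex) = of_nat (2 * n + 8 * n * n)"
    by simp
  then have "(2 * of_nat n + 8 * of_nat n * of_nat n :: complex) \<noteq> 0"
    using 0 by (simp only: of_nat_eq_0_iff)
  ultimately show ?case by simp
next
  case (Suc k)
  have "(of_nat (2 * k + 1) + 1 - 2 * of_nat n :: complex) = of_nat (2 * (k + 1)) - of_nat (2 * n)"
    by simp
  also have "\<dots> \<noteq> 0"
  proof -
    have "2 * (k + 1) \<noteq> 2 * n" using Suc.prems by simp
    then show ?thesis by (simp only: right_minus_eq of_nat_eq_iff not_False_eq_True)
  qed
  finally have 1: "(of_nat (2 * k + 1) + 1 - 2 * of_nat n :: complex) \<noteq> 0" .
  have "(of_nat (2 * k + 1) - 4 * of_nat n :: complex) = of_nat (2 * k + 1) - of_nat (4 * n)" by simp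
  also have "\<dots> \<noteq> 0"
  proof -
    have "2 * k + 1 \<noteq> 4 * n" using Suc.prems by simp
    then show ?thesis by (simp only: right_minus_eq of_nat_eq_iff not_False_eq_True)
  qed
  finally have 2: "(of_nat (2 * k + 1) - 4 * of_nat n :: complex) \<noteq> 0" .
  have "of_nat (2 * k + 1 + 2) \<noteq> (0 :: complex)" by (simp only: of_nat_eq_0_iff)
  with 1 2 coeff_bessel_q_step[of "2 * k + 1" n] Suc show ?case
    by (simp del: of_nat_add of_nat_mult)
qed

text \<open>The recurrence at \<open>m = 2k\<close>, divided by 4. For \<open>k < n\<close> the
  natural factors are all positive, so the minus sign shows the alternation.\<close>

lemma coeff_bessel_q_even_Suc:
  assumes "k < n"
  shows "of_nat ((k + 1) * (2 * n - 2 * k - 1) * (2 * n - k)) * coeff (bessel_q n) (2 * (k + 1))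
         = - of_nat (2 * (n - k)) * coeff (bessel_q n) (2 * k)"
proof -
  obtain d where n: "n = Suc (k + d)" using assms by (metis less_iff_Suc_add)
  have "4 * (of_nat ((k + 1) * (2 * n - 2 * k - 1) * (2 * n - k)) * coeff (bessel_q n) (2 * (k + 1)))
         = 4 * (- of_nat (2 * (n - k)) * coeff (bessel_q n) (2 * k))"
    using coeff_bessel_q_step[of "2 * k" n] by (simp add: n algebra_simps)
  then show ?thesis by (simp only: mult_cancel_left) simp
qed

lemma coeff_bessel_q_2:
  assumes "n \<ge> 1"
  shows "coeff (bessel_q n) 2 = - coeff (bessel_q n) 0 / (2 * of_nat n - 1)"
proof -
  have r: "2 * of_nat n - 1 = (of_nat (2 * n - 1) :: complex)"
    using assms by (simp add: of_nat_diff)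
  have "(0 + 1) * (2 * n - 2 * 0 - 1) * (2 * n - 0) = 2 * n * (2 * n - 1)"
    by (simp add: mult.commute)
  then have "of_nat (2 * n) * (of_nat (2 * n - 1) * coeff (bessel_q n) 2)
      = of_nat ((0 + 1) * (2 * n - 2 * 0 - 1) * (2 * n - 0)) * coeff (bessel_q n) (2 * (0 + 1))"
    by (simp only: of_nat_mult mult.assoc add_0 mult_1_right)
  also have "\<dots> = of_nat (2 * n) * (- coeff (bessel_q n) 0)"
    using assms by (subst coeff_bessel_q_even_Suc) simp_all
  finally have "of_nat (2 * n - 1) * coeff (bessel_q n) 2 = - coeff (bessel_q n) 0"
    using assms by (subst (asm) mult_cancel_left) simp
  moreover have "of_nat (2 * n - 1) \<noteq> (0 :: complex)"
    using assms by (simp only: of_nat_eq_0_iff)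
  ultimately show ?thesis unfolding r by (metis nonzero_mult_div_cancel_left)
qed

text \<open>In the recurrence, \<open>(k+1)(2n-k) = 2n + k(2n-k-1)\<close> is at least
  \<open>2n\<close>, and \<open>2n-2k-1\<close> is at least \<open>n-k\<close>.\<close>

lemma norm_coeff_bessel_q_even_Suc_le:
  assumes "k < n"
  shows "real n * cmod (coeff (bessel_q n) (2 * (k + 1))) \<le> cmod (coeff (bessel_q n) (2 * k))"
proof -
  define p where "p = (k + 1) * (2 * n - k)"
  define r where "r = 2 * n - 2 * k - 1"
  have "2 * n \<le> p"
  proof -
    obtain d where "n = Suc (k + d)" using assms by (metis less_iff_Suc_add)
    then show ?thesis by (simp add: p_def algebra_simps)
  qed
  moreover have "n - k \<le> r" "r > 0" "n - k > 0" using assms by (auto simp: r_def)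
  ultimately have "(2 * n) * (n - k) \<le> p * r" by (intro mult_mono) auto
  then have "real (2 * n * (n - k)) \<le> real (p * r)" by (rule of_nat_mono)
  moreover have pr: "p * r = (k + 1) * (2 * n - 2 * k - 1) * (2 * n - k)"
    by (simp only: p_def r_def mult_ac)
  have "real (p * r) * cmod (coeff (bessel_q n) (2 * (k + 1)))
    = real (2 * (n - k)) * cmod (coeff (bessel_q n) (2 * k))"
    using arg_cong[OF coeff_bessel_q_even_Suc[OF assms], of cmod]
    unfolding pr[symmetric] by (simp add: norm_mult del: of_nat_mult)
  ultimately have "real (2 * n * (n - k)) * cmod (coeff (bessel_q n) (2 * (k + 1)))
    \<le> real (2 * (n - k)) * cmod (coeff (bessel_q n) (2 * k))"
    by (metis mult_right_mono norm_ge_zero)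
  then have "real (2 * (n - k)) * (real n * cmod (coeff (bessel_q n) (2 * (k + 1))))
    \<le> real (2 * (n - k)) * cmod (coeff (bessel_q n) (2 * k))"
    by (simp add: mult_ac)
  then show ?thesis using \<open>n - k > 0\<close> by (subst (asm) mult_le_cancel_left_pos) auto
qed

section \<open>Value at the origin and size of \<open>q\<close>\<close>

lemma degree_bessel_q: "degree (bessel_q n) = 2 * n"
proof -
  have "bessel_theta n \<noteq> 0" "bessel_theta_neg n \<noteq> 0"
    using lead_coeff_bessel_theta[of n] lead_coeff_bessel_theta_neg[of n] by force+
  then show ?thesis
    by (simp add: bessel_q_def degree_mult_eq degree_bessel_theta degree_bessel_theta_neg)
qed

lemma coeff_bessel_q_0: "coeff (bessel_q n) 0 = (fact (2 * n) / (fact n * 2 ^ n))\<^sup>2"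
  by (simp add: bessel_q_def bessel_theta_neg_def coeff_mult_0 coeff_pcompose_0 poly_0_coeff_0
      coeff_bessel_theta power2_eq_square)

lemma bessel_q_even_sum: "poly (bessel_q n) s = (\<Sum>k<Suc n. coeff (bessel_q n) (2 * k) * (s\<^sup>2) ^ k)"
proof -
  let ?c = "coeff (bessel_q n)"
  have "poly (bessel_q n) s = (\<Sum>i<2 * Suc n. ?c i * s ^ i)"
    unfolding poly_altdef degree_bessel_q
    by (rule sum.mono_neutral_left) (auto simp: coeff_eq_0 degree_bessel_q)
  also have "\<dots> = (\<Sum>i<2 * Suc n. if even i then ?c i * s ^ i else 0)"
  proof (rule sum.cong)
    fix i
    \<comment> \<open>Below \<open>2n\<close> this is the recurrence, above it the degree.\<close>
    have "?c i = 0" if "odd i"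
    proof -
      obtain k where "i = 2 * k + 1" using \<open>odd i\<close> by (rule oddE)
      then show ?thesis
        using coeff_bessel_q_odd[of k n] coeff_eq_0[of "bessel_q n" i]
        by (cases "k < n") (simp_all add: degree_bessel_q)
    qed
    then show "?c i * s ^ i = (if even i then ?c i * s ^ i else 0)" by simp
  qed simp
  also have "\<dots> = (\<Sum>k<Suc n. ?c (2 * k) * s ^ (2 * k))"
  proof -
    have "(\<Sum>i<2 * m. if even i then ?c i * s ^ i else 0) = (\<Sum>k<m. ?c (2 * k) * s ^ (2 * k))" for m
      by (induction m) simp_all
    then show ?thesis .
  qed
  finally show ?thesis by (simp add: power_mult)
qed

text \<open>The first two terms in \<open>s^2\<close> are kept exactly. By the decay of the
  coefficients each later term is at most half its predecessor, so the tail is at most the modulus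
  of the \<open>s^2\<close> term, which is the right side.\<close>

lemma bessel_q_estimate:
  assumes "n \<ge> 1" and s: "(cmod s)\<^sup>2 \<le> (real n + 1) / 4"
  defines "D \<equiv> coeff (bessel_q n) 0"
  shows "cmod (poly (bessel_q n) s - D * (1 - s\<^sup>2 / (2 * of_nat n - 1)))
         \<le> cmod D * ((cmod s)\<^sup>2 / (2 * real n - 1))"
proof -
  let ?c = "\<lambda>k. coeff (bessel_q n) (2 * k)"
  obtain d where n: "n = Suc d" using assms by (metis Suc_le_D One_nat_def)
  have r: "(cmod s)\<^sup>2 \<le> real n / 2" using s assms(1) by simp
  define t where "t = s\<^sup>2"
  have t: "(cmod s)\<^sup>2 = cmod t" by (simp add: t_def norm_power)
  have step: "cmod (?c (Suc k)) * cmod t \<le> cmod (?c k) / 2" if "k < n" for k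
  proof -
    have "cmod (?c (Suc k)) * cmod t \<le> cmod (?c (Suc k)) * (real n / 2)"
      using r unfolding t by (rule mult_left_mono) simp
    also have "\<dots> \<le> cmod (?c k) / 2"
      using norm_coeff_bessel_q_even_Suc_le[OF that] by (simp add: mult_ac)
    finally show ?thesis .
  qed
  define M where "M = cmod (?c 1) * cmod t"
  have geo: "cmod (?c (Suc k) * t ^ Suc k) \<le> M * (1 / 2) ^ k" if "k < n" for k
    using that
  proof (induction k)
    case 0
    then show ?case by (simp add: M_def norm_mult)
  next
    case (Suc k)
    have "cmod (?c (Suc (Suc k)) * t ^ Suc (Suc k))
      = (cmod (?c (Suc (Suc k))) * cmod t) * cmod t ^ Suc k"
      by (simp add: norm_mult norm_power)
    also have "\<dots> \<le> cmod (?c (Suc k)) / 2 * cmod t ^ Suc k"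
      using step[OF Suc.prems] by (rule mult_right_mono) simp
    also have "\<dots> = cmod (?c (Suc k) * t ^ Suc k) / 2"
      by (simp add: norm_mult norm_power)
    also have "\<dots> \<le> M * (1 / 2) ^ Suc k" using Suc by simp
    finally show ?case .
  qed
  have c1: "?c 1 = - D / (2 * of_nat n - 1)"
    using coeff_bessel_q_2[OF assms(1)] by (simp add: D_def)
  have "poly (bessel_q n) s = D + ?c 1 * t + (\<Sum>k<d. ?c (Suc (Suc k)) * t ^ Suc (Suc k))"
    unfolding bessel_q_even_sum n sum.lessThan_Suc_shift by (simp add: D_def n t_def)
  then have "poly (bessel_q n) s - D * (1 - s\<^sup>2 / (2 * of_nat n - 1))
    = (\<Sum>k<d. ?c (Suc (Suc k)) * t ^ Suc (Suc k))"
    unfolding c1 t_def by (simp add: algebra_simps)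
  also have "cmod \<dots> \<le> (\<Sum>k<d. M * (1 / 2) ^ Suc k)"
    by (rule sum_norm_le, rule geo) (use n in auto)
  also have "\<dots> = M * (\<Sum>k<d. (1 / 2) ^ Suc k)" by (simp add: sum_distrib_left)
  also have "(\<Sum>k<d. (1 / 2) ^ Suc k) = 1 - (1 / 2 :: real) ^ d"
    by (induction d) simp_all
  also have "M * (1 - (1 / 2) ^ d) \<le> M"
    by (rule mult_left_le) (simp_all add: M_def)
  also have "M = cmod D * ((cmod s)\<^sup>2 / (2 * real n - 1))"
  proof -
    have "cmod (2 * of_nat n - 1) = cmod (of_real (2 * real n - 1))" by simp
    also have "\<dots> = 2 * real n - 1" unfolding norm_of_real using assms(1) by simp
    finally show ?thesis unfolding M_def c1 t by (simp add: norm_divide)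
  qed
  finally show ?thesis .
qed

text \<open>The \<open>s^2\<close> term and the tail each cost at most a fraction \<open>e\<close>
  of \<open>q(0)\<close>, and \<open>2 e <= 1/2\<close>.\<close>

lemma norm_bessel_q_ge:
  assumes "n \<ge> 2" and s: "(cmod s)\<^sup>2 \<le> (real n + 1) / 4"
  shows "cmod (coeff (bessel_q n) 0) / 2 \<le> cmod (poly (bessel_q n) s)"
proof -
  define D where "D = coeff (bessel_q n) 0"
  define e where "e = (cmod s)\<^sup>2 / (2 * real n - 1)"
  have "cmod (2 * of_nat n - 1) = cmod (of_real (2 * real n - 1))" by simp
  also have "\<dots> = 2 * real n - 1" unfolding norm_of_real using assms(1) by simp
  finally have N: "cmod (2 * of_nat n - 1) = 2 * real n - 1" .
  define A where "A = D * (s\<^sup>2 / (2 * of_nat n - 1))"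
  define B where "B = poly (bessel_q n) s - D * (1 - s\<^sup>2 / (2 * of_nat n - 1))"
  have "poly (bessel_q n) s = (D - A) + B" by (simp add: A_def B_def algebra_simps)
  then have "cmod D - cmod A - cmod B \<le> cmod (poly (bessel_q n) s)"
    using norm_diff_ineq[of "D - A" B] norm_triangle_ineq2[of D A] by simp
  also have "cmod A = cmod D * e"
    by (simp add: A_def norm_mult norm_divide norm_power N e_def)
  finally have "cmod D - 2 * (cmod D * e) \<le> cmod (poly (bessel_q n) s)"
    using bessel_q_estimate[of n s] assms by (simp add: D_def e_def B_def)
  \<comment> \<open>Here \<open>n + 1 <= 2n - 1\<close>, that is \<open>n >= 2\<close>, is
    used.\<close>
  moreover have "e \<le> 1 / 4" using s assms(1) by (simp add: e_def divide_simps)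
  then have "cmod D * e \<le> cmod D * (1 / 4)" by (rule mult_left_mono) simp
  ultimately show ?thesis by (simp add: D_def)
qed

text \<open>For real \<open>s\<close> the \<open>s^2\<close> term lowers the modulus by the fraction
  \<open>e\<close>, and the tail restores at most the same amount.\<close>

lemma norm_bessel_q_of_real_le:
  assumes "n \<ge> 2" and s: "s\<^sup>2 \<le> (real n + 1) / 4"
  shows "cmod (poly (bessel_q n) (of_real s)) \<le> cmod (coeff (bessel_q n) 0)"
proof -
  define D where "D = coeff (bessel_q n) 0"
  define e where "e = s\<^sup>2 / (2 * real n - 1)"
  have e: "0 \<le> e" "e \<le> 1" using s assms(1) by (simp_all add: e_def divide_simps)
  have "(of_real s)\<^sup>2 / (2 * of_nat n - 1) = complex_of_real e" by (simp add: e_def)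
  moreover have "cmod (of_real s) ^ 2 = s\<^sup>2" by simp
  ultimately have "cmod (poly (bessel_q n) (of_real s) - D * of_real (1 - e)) \<le> cmod D * e"
    using bessel_q_estimate[of n "of_real s"] assms by (simp add: D_def e_def)
  moreover have "cmod (D * of_real (1 - e)) = cmod D * (1 - e)"
    unfolding norm_mult norm_of_real using e by simp
  ultimately show ?thesis
    using norm_triangle_sub[of "poly (bessel_q n) (of_real s)" "D * of_real (1 - e)"]
    by (simp add: D_def algebra_simps)
qed

subsection \<open>Partial fractions over the zeros\<close>

lemma poly_bessel_theta_neg: "poly (bessel_theta_neg n) s = poly (bessel_theta n) (- s)"
  by (simp add: bessel_theta_neg_def poly_pcompose)

lemma poly_bessel_q: "poly (bessel_q n) s = poly (bessel_theta n) s * poly (bessel_theta n) (- s)"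
  by (simp add: bessel_q_def poly_bessel_theta_neg)

lemma poly_bessel_theta_0: "poly (bessel_theta n) 0 \<noteq> 0"
  by (simp add: poly_0_coeff_0 coeff_bessel_theta)

lemma poly_bessel_theta_wronskian:
  assumes "n \<ge> 1"
  shows "poly (pderiv (bessel_theta n)) s * poly (bessel_theta n) (- s)
           + poly (bessel_theta n) s * poly (pderiv (bessel_theta n)) (- s)
         = 2 * poly (bessel_q n) s - 2 * (-1) ^ n * s ^ (2 * n)"
  using arg_cong[OF bessel_theta_wronskian[OF assms], of "\<lambda>p. poly p s"]
  by (simp add: pderiv_bessel_theta_neg(1) poly_bessel_theta_neg poly_bessel_q poly_pcompose
      poly_monom algebra_simps)

text \<open>At a common zero \<open>a\<close> of \<open>theta\<close> and its derivative the
  Wronskian identity leaves \<open>a^(2n) = 0\<close>, but \<open>theta(0)\<close> is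
  nonzero.\<close>

lemma rsquarefree_bessel_theta:
  assumes "n \<ge> 1"
  shows "rsquarefree (bessel_theta n)"
  unfolding rsquarefree_roots
proof safe
  fix a assume a: "poly (bessel_theta n) a = 0" "poly (pderiv (bessel_theta n)) a = 0"
  then have "a = 0"
    using poly_bessel_theta_wronskian[OF assms, of a] by (simp add: poly_bessel_q)
  with a show False using poly_bessel_theta_0 by simp
qed

text \<open>No exception at \<open>\<alpha> = 0\<close> arises: \<open>inverse 0 = 0\<close>, and
  neither polynomial vanishes at 0.\<close>

lemma bessel_zeros_iff:
  "\<alpha> \<in> bessel_zeros n \<longleftrightarrow> poly (bessel_theta n) (inverse \<alpha>) = 0"
proof (cases "\<alpha> = 0")
  case True
  have "poly (bessel_poly n) 0 \<noteq> 0" by (simp add: poly_0_coeff_0 coeff_bessel_poly)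
  with True poly_bessel_theta_0[of n] show ?thesis by (simp add: bessel_zeros_def)
next
  case False
  then show ?thesis by (simp add: bessel_zeros_def bessel_theta_def poly_reflect_poly_nz)
qed

lemma bij_betw_bessel_zeros:
  "bij_betw inverse {b. poly (bessel_theta n) b = 0} (bessel_zeros n)"
  by (rule bij_betw_byWitness[where f' = inverse]) (auto simp: bessel_zeros_iff)

text \<open>A vanishing denominator would make \<open>s\<close> or \<open>-s\<close> the reciprocal
  of a zero, hence a root of \<open>theta\<close>, and then \<open>q(s) = 0\<close>.\<close>

lemma bessel_zeros_denominators_nonzero:
  assumes "\<alpha> \<in> bessel_zeros n" "poly (bessel_q n) s \<noteq> 0"
  shows "1 + \<alpha> * s \<noteq> 0" "1 - \<alpha> * s \<noteq> 0"
proof -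
  have nz: "inverse \<alpha> \<noteq> s" "inverse \<alpha> \<noteq> - s"
    using assms by (auto simp: bessel_zeros_iff poly_bessel_q)
  show "1 - \<alpha> * s \<noteq> 0"
    using nz(1) inverse_unique[of \<alpha> s] by auto
  show "1 + \<alpha> * s \<noteq> 0"
    using nz(2) inverse_unique[of \<alpha> "- s"] by (auto simp: add_eq_0_iff)
qed

lemma poly_pderiv_prod_linear:
  fixes s :: "'a :: field_char_0"
  assumes "finite R" "s \<notin> R"
  shows "poly (pderiv (\<Prod>b\<in>R. [:- b, 1:])) s = poly (\<Prod>b\<in>R. [:- b, 1:]) s * (\<Sum>b\<in>R. 1 / (s - b))"
  using assms
proof (induction R rule: finite_induct)
  case (insert b R)
  then show ?case
    by (simp add: pderiv_mult pderiv_pCons field_simps del: mult_pCons_left)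
qed simp

text \<open>As \<open>theta\<close> is monic and square-free, it is the product of
  \<open>s - b\<close> over its root set, so no multiplicities enter.\<close>

lemma bessel_theta_log_deriv:
  assumes "n \<ge> 1" "poly (bessel_theta n) s \<noteq> 0"
  shows "poly (pderiv (bessel_theta n)) s / poly (bessel_theta n) s
         = (\<Sum>b | poly (bessel_theta n) b = 0. 1 / (s - b))"
proof -
  let ?R = "{b. poly (bessel_theta n) b = 0}"
  have "bessel_theta n \<noteq> 0" using poly_bessel_theta_0[of n] by auto
  then have "finite ?R" by (rule poly_roots_finite)
  moreover have "(\<Prod>b\<in>?R. [:- b, 1:]) = bessel_theta n"
    using complex_poly_decompose_rsquarefree[OF rsquarefree_bessel_theta[OF assms(1)]]
    by (simp add: degree_bessel_theta lead_coeff_bessel_theta)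
  ultimately show ?thesis
    using poly_pderiv_prod_linear[of ?R s] assms(2) by simp
qed

text \<open>With \<open>b = 1/\<alpha>\<close> the sum becomes \<open>s\<close> times the
  logarithmic derivatives of \<open>theta\<close> at \<open>s\<close> and \<open>-s\<close> added
  together. Over the common denominator \<open>q(s)\<close> the numerator is given by the Wronskian
  identity.\<close>

lemma sum_bessel_zeros_partial_fractions:
  assumes "n \<ge> 1" "poly (bessel_q n) s \<noteq> 0"
  shows "(\<Sum>\<alpha>\<in>bessel_zeros n. 1 / (1 + \<alpha> * s) - 1 / (1 - \<alpha> * s))
         = 2 * s - 2 * (-1) ^ n * s ^ (2 * n + 1) / poly (bessel_q n) s"
proof -
  let ?T = "poly (bessel_theta n)" and ?R = "{b. poly (bessel_theta n) b = 0}"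
  have nz: "?T s \<noteq> 0" "?T (- s) \<noteq> 0" using assms(2) by (auto simp: poly_bessel_q)
  have "(\<Sum>\<alpha>\<in>bessel_zeros n. 1 / (1 + \<alpha> * s) - 1 / (1 - \<alpha> * s))
      = (\<Sum>b\<in>?R. 1 / (1 + inverse b * s) - 1 / (1 - inverse b * s))"
    by (rule sum.reindex_bij_betw[OF bij_betw_bessel_zeros, symmetric])
  also have "\<dots> = (\<Sum>b\<in>?R. s * (1 / (s - b) + 1 / (- s - b)))"
  proof (rule sum.cong)
    fix b assume "b \<in> ?R"
    with nz poly_bessel_theta_0[of n] have b: "b \<noteq> 0" "s - b \<noteq> 0" "- s - b \<noteq> 0"
      by auto
    \<comment> \<open>Since \<open>m - p = -2s\<close> and \<open>m + p = -2b\<close>, both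
      \<open>b (m - p)\<close> and \<open>s (m + p)\<close> equal \<open>-2 b s\<close>.\<close>
    define p m where "p = s - b" and "m = - s - b"
    have pm: "p \<noteq> 0" "m \<noteq> 0" using b by (simp_all add: p_def m_def)
    have "1 + inverse b * s = - m / b" "1 - inverse b * s = - p / b"
      using b(1) by (simp_all add: p_def m_def field_simps)
    then have "1 / (1 + inverse b * s) - 1 / (1 - inverse b * s) = b / p - b / m"
      by simp
    also have "\<dots> = b * (m - p) / (p * m)" using pm by (simp add: field_simps)
    also have "b * (m - p) = s * (m + p)" by (simp add: p_def m_def algebra_simps)
    also have "s * (m + p) / (p * m) = s * (1 / p + 1 / m)" using pm by (simp add: field_simps)
    also have "\<dots> = s * (1 / (s - b) + 1 / (- s - b))" by (simp only: p_def m_def)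
    finally show "1 / (1 + inverse b * s) - 1 / (1 - inverse b * s) = s * (1 / (s - b) + 1 / (- s - b))" .
  qed simp
  also have "\<dots> = s * (poly (pderiv (bessel_theta n)) s / ?T s + poly (pderiv (bessel_theta n)) (- s) / ?T (- s))"
    unfolding bessel_theta_log_deriv[OF assms(1) nz(1)] bessel_theta_log_deriv[OF assms(1) nz(2)]
    by (simp add: sum_distrib_left sum.distrib ring_distribs)
  also have "\<dots> = s * ((poly (pderiv (bessel_theta n)) s * ?T (- s) + ?T s * poly (pderiv (bessel_theta n)) (- s))
      / poly (bessel_q n) s)"
    using nz by (simp add: poly_bessel_q divide_simps)
  also have "\<dots> = 2 * s - 2 * (-1) ^ n * s ^ (2 * n + 1) / poly (bessel_q n) s"
    unfolding poly_bessel_theta_wronskian[OF assms(1)] using assms(2) by (simp add: divide_simps) (simp add: algebra_simps)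
  finally show ?thesis .
qed

section \<open>Closed form for the geometric series\<close>

lemma shifted_zero_factors:
  fixes z \<alpha> :: complex
  assumes "z \<noteq> 1"
  shows "1 - (1 - \<alpha> / 2) * z = (1 - z) * (1 + \<alpha> * (z / (1 - z) / 2))"
    and "1 - (1 + \<alpha> / 2) * z = (1 - z) * (1 - \<alpha> * (z / (1 - z) / 2))"
proof -
  have 1: "(1 - z) * (w / 2) = (1 - z) * w / 2" for w by simp
  have 2: "(1 - z) * (z / (1 - z)) = z" using assms by simp
  define w where "w = z / (1 - z) / 2"
  have w: "\<alpha> * z / 2 = (1 - z) * (\<alpha> * w)"
    unfolding w_def mult.left_commute[of "1 - z"] by (simp only: 1 2) simp
  show "1 - (1 - \<alpha> / 2) * z = (1 - z) * (1 + \<alpha> * (z / (1 - z) / 2))"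
    and "1 - (1 + \<alpha> / 2) * z = (1 - z) * (1 - \<alpha> * (z / (1 - z) / 2))"
    unfolding w_def[symmetric] distrib_left right_diff_distrib w[symmetric]
    by (simp_all add: algebra_simps)
qed

text \<open>
  This is \<open>r\<^sub>n\<close> of \<open>g(w) = w/(1-w)\<close>, with \<open>g\<close> replaced by \<open>1/(1-w) = g(w) + 1\<close> in the differences, so
  that its power series is a combination of geometric series.
\<close>

definition rn_geo :: "nat \<Rightarrow> complex \<Rightarrow> complex" where
  "rn_geo n z = z / (1 - z)\<^sup>2
     - (\<Sum>\<alpha>\<in>bessel_zeros n. 1 / (1 - (1 - \<alpha> / 2) * z) - 1 / (1 - (1 + \<alpha> / 2) * z))"

text \<open>In the variable \<open>s = z/(2(1-z))\<close> the sum is the partial fraction sum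
  divided by \<open>1 - z\<close>. Its linear part cancels the derivative term, and only the
  contribution of the Wronskian remains.\<close>

lemma rn_geo_eq:
  assumes "n \<ge> 1" "z \<noteq> 1" "poly (bessel_q n) (z / (1 - z) / 2) \<noteq> 0"
  shows "rn_geo n z = z ^ (2 * n + 1)
     * ((-1) ^ n / (4 ^ n * (1 - z) ^ (2 * n + 2) * poly (bessel_q n) (z / (1 - z) / 2)))"
proof -
  define s where "s = z / (1 - z) / 2"
  have z: "1 - z \<noteq> 0" using assms(2) by simp
  have "1 / (1 - (1 - \<alpha> / 2) * z) - 1 / (1 - (1 + \<alpha> / 2) * z)
     = (1 / (1 + \<alpha> * s) - 1 / (1 - \<alpha> * s)) / (1 - z)" for \<alpha>
  proof -
    show ?thesis unfolding s_def using shifted_zero_factors[OF assms(2)] by (simp add: diff_divide_distrib mult.commute)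
  qed
  then have "rn_geo n z = z / (1 - z)\<^sup>2
      - (\<Sum>\<alpha>\<in>bessel_zeros n. 1 / (1 + \<alpha> * s) - 1 / (1 - \<alpha> * s)) / (1 - z)"
    by (simp add: rn_geo_def sum_divide_distrib)
  also have "(\<Sum>\<alpha>\<in>bessel_zeros n. 1 / (1 + \<alpha> * s) - 1 / (1 - \<alpha> * s))
      = 2 * s - 2 * (-1) ^ n * s ^ (2 * n + 1) / poly (bessel_q n) s"
    using assms(1,3) by (intro sum_bessel_zeros_partial_fractions) (simp_all add: s_def)
  also have "z / (1 - z)\<^sup>2 = 2 * s / (1 - z)"
  proof -
    have "2 * (w / 2) = w" for w :: complex by simp
    then have "2 * s = z / (1 - z)" unfolding s_def .
    then show ?thesis by (simp add: power2_eq_square)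
  qed
  also have "2 * s / (1 - z) - (2 * s - 2 * (-1) ^ n * s ^ (2 * n + 1) / poly (bessel_q n) s) / (1 - z)
      = 2 * (-1) ^ n * s ^ (2 * n + 1) / (poly (bessel_q n) s * (1 - z))"
    by (simp add: diff_divide_distrib mult.commute)
  \<comment> \<open>The prefactor 2 and the \<open>2n+1\<close> halvings in \<open>s\<close> combine
    to \<open>1/4^n\<close>.\<close>
  also have "s ^ (2 * n + 1) = z ^ (2 * n + 1) / ((1 - z) ^ (2 * n + 1) * (2 * 4 ^ n))"
  proof -
    have "(t / 2) ^ (2 * n + 1) = t ^ (2 * n + 1) / (2 * 4 ^ n)" for t :: complex
      by (simp add: power_divide power_mult)
    then have "s ^ (2 * n + 1) = (z / (1 - z)) ^ (2 * n + 1) / (2 * 4 ^ n)" unfolding s_def .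
    then show ?thesis by (simp only: power_divide divide_divide_eq_left)
  qed
  finally show ?thesis unfolding s_def[symmetric] by (simp add: mult_ac)
qed

text \<open>The two constants in \<open>w/(1-w) = 1/(1-w) - 1\<close> cancel in each difference;
  \<open>q(s) \<noteq> 0\<close> keeps all denominators nonzero.\<close>

lemma rn_geometric:
  assumes "n \<ge> 1" "z \<noteq> 1" "poly (bessel_q n) (z / (1 - z) / 2) \<noteq> 0"
  shows "rn n (\<lambda>w. w / (1 - w)) z = rn_geo n z"
proof -
  have "((\<lambda>w. w / (1 - w)) has_field_derivative 1 / (1 - z)\<^sup>2) (at z)"
    using assms(2) by (auto intro!: derivative_eq_intros simp: power2_eq_square divide_simps)
  then have d: "deriv (\<lambda>w. w / (1 - w)) z = 1 / (1 - z)\<^sup>2" by (rule DERIV_imp_deriv)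
  show ?thesis
    unfolding rn_def d rn_geo_def
  proof (rule arg_cong2[where f = minus], goal_cases)
    case 2
    show ?case
    proof (rule sum.cong)
      fix \<alpha> assume \<alpha>: "\<alpha> \<in> bessel_zeros n"
      define a b where "a = (1 - \<alpha> / 2) * z" and "b = (1 + \<alpha> / 2) * z"
      have "1 - a \<noteq> 0" "1 - b \<noteq> 0"
        unfolding a_def b_def shifted_zero_factors[OF assms(2)]
        using bessel_zeros_denominators_nonzero[OF \<alpha> assms(3)] assms(2) by simp_all
      then have "a / (1 - a) = 1 / (1 - a) - 1" "b / (1 - b) = 1 / (1 - b) - 1"
        by (simp_all add: field_simps)
      then show "a / (1 - a) - b / (1 - b) = 1 / (1 - a) - 1 / (1 - b)" by simp
    qed simp
  qed simp
qed

subsection \<open>Power series\<close>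

text \<open>The quotient \<open>z/(1-z)\<close> is largest in modulus at \<open>z = x\<close>, where
  the condition coming from \<open>n0\<close> bounds it.\<close>

lemma norm_mobius_le:
  fixes z :: complex
  assumes "0 < x" "x < 1" "x\<^sup>2 / (1 - x)\<^sup>2 \<le> real n + 1" "cmod z \<le> x"
  shows "(cmod (z / (1 - z) / 2))\<^sup>2 \<le> (real n + 1) / 4"
proof -
  have "1 - x \<le> cmod (1 - z)" using norm_triangle_ineq2[of 1 z] assms(4) by simp
  then have "cmod (z / (1 - z)) \<le> x / (1 - x)"
    unfolding norm_divide using assms by (intro frac_le) auto
  then have "(cmod (z / (1 - z)))\<^sup>2 \<le> (x / (1 - x))\<^sup>2" by (rule power_mono) simp
  also have "\<dots> \<le> real n + 1" using assms(3) by (simp add: power_divide)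
  finally have "(cmod (z / (1 - z)))\<^sup>2 \<le> real n + 1" .
  then have le: "(cmod (z / (1 - z)))\<^sup>2 / 4 \<le> (real n + 1) / 4" by (rule divide_right_mono) simp
  have "(cmod (w / 2))\<^sup>2 = (cmod w)\<^sup>2 / 4" for w
    by (simp add: norm_divide power_divide)
  from this[of "z / (1 - z)"] le show ?thesis by (simp only:)
qed

lemma norm_coeff_bessel_q_0: "cmod (coeff (bessel_q n) 0) = (fact (2 * n) / (fact n * 2 ^ n))\<^sup>2"
  by (simp add: coeff_bessel_q_0 norm_power norm_divide norm_mult)

lemma norm_coeff_bessel_q_0_inverse:
  "1 / (4 ^ n * cmod (coeff (bessel_q n) 0)) = (fact n)\<^sup>2 / (fact (2 * n))\<^sup>2"
proof -
  have "(2 ^ n)\<^sup>2 = (4 ^ n :: real)" by (simp add: power2_eq_square flip: power_mult_distrib)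
  then show ?thesis by (simp add: norm_coeff_bessel_q_0 power_divide power_mult_distrib)
qed

lemma poly_bessel_q_nonzero:
  assumes "n \<ge> 2" "(cmod s)\<^sup>2 \<le> (real n + 1) / 4"
  shows "poly (bessel_q n) s \<noteq> 0"
  using norm_bessel_q_ge[OF assms] by (auto simp: norm_coeff_bessel_q_0)

text \<open>The lower bound on \<open>|q|\<close> keeps the reciprocals \<open>1/\<alpha>\<close>
  outside the disc of radius \<open>x/(2(1-x))\<close>. This places all points
  \<open>(1 \<plusminus> \<alpha>/2) z\<close> with \<open>|z| <= x\<close> in the unit disc, where
  the series converge.\<close>

lemma bessel_zeros_norm_less:
  assumes "\<alpha> \<in> bessel_zeros n" "0 < x" "x < 1" "n \<ge> 2" "x\<^sup>2 / (1 - x)\<^sup>2 \<le> real n + 1"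
  shows "x * (1 + cmod \<alpha> / 2) < 1"
proof -
  have a: "\<alpha> \<noteq> 0" using assms(1) poly_bessel_theta_0[of n] by (auto simp: bessel_zeros_iff)
  have "poly (bessel_q n) (inverse \<alpha>) = 0" using assms(1) by (simp add: bessel_zeros_iff poly_bessel_q)
  then have "(cmod (inverse \<alpha>))\<^sup>2 > (real n + 1) / 4"
    using poly_bessel_q_nonzero[OF assms(4)] by force
  have "(x / (1 - x) / 2)\<^sup>2 = x\<^sup>2 / (1 - x)\<^sup>2 / 4"
    by (simp only: power_divide) simp
  also have "\<dots> \<le> (real n + 1) / 4" using assms(5) by (rule divide_right_mono) simp
  also have "\<dots> < (cmod (inverse \<alpha>))\<^sup>2" by fact
  finally have "x / (1 - x) / 2 < cmod (inverse \<alpha>)" by (rule power_less_imp_less_base) simp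
  also have "cmod (inverse \<alpha>) = 1 / cmod \<alpha>" by (simp add: inverse_eq_divide norm_divide)
  finally have "x * cmod \<alpha> < 2 * (1 - x)"
    using a assms(2,3) by (simp add: divide_simps mult_ac)
  then show ?thesis by (simp add: algebra_simps)
qed

text \<open>The multiplier by which \<open>r_n\<close> acts on the monomial
  \<open>z^m\<close>.\<close>

definition rn_coeff :: "nat \<Rightarrow> nat \<Rightarrow> complex" where
  "rn_coeff n m = of_nat m - (\<Sum>\<alpha>\<in>bessel_zeros n. (1 - \<alpha> / 2) ^ m - (1 + \<alpha> / 2) ^ m)"

section \<open>Action of \<open>rn\<close> on power series\<close>

lemma norm_shifted_zero_less:
  assumes "\<alpha> \<in> bessel_zeros n" "0 < x" "x < 1" "n \<ge> 2" "x\<^sup>2 / (1 - x)\<^sup>2 \<le> real n + 1" "cmod z \<le> x"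
  shows "cmod ((1 - \<alpha> / 2) * z) < 1" "cmod ((1 + \<alpha> / 2) * z) < 1"
proof -
  have *: "cmod (w * z) < 1" if "cmod w \<le> 1 + cmod \<alpha> / 2" for w
  proof -
    have "cmod (w * z) \<le> (1 + cmod \<alpha> / 2) * x"
      unfolding norm_mult using that assms(6) by (intro mult_mono) auto
    also have "\<dots> < 1" using bessel_zeros_norm_less[OF assms(1-5)] by (simp add: mult.commute)
    finally show ?thesis .
  qed
  show "cmod ((1 - \<alpha> / 2) * z) < 1" by (rule *) (use norm_triangle_ineq4[of 1 "\<alpha> / 2"] in \<open>simp add: norm_divide\<close>)
  show "cmod ((1 + \<alpha> / 2) * z) < 1" by (rule *) (use norm_triangle_ineq[of 1 "\<alpha> / 2"] in \<open>simp add: norm_divide\<close>)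
qed

lemma summable_bounded_coeffs:
  fixes c :: "nat \<Rightarrow> complex"
  assumes "\<And>m. norm (c m) \<le> 1" "cmod z < 1"
  shows "summable (\<lambda>m. c m * z ^ m)"
proof (rule summable_comparison_test')
  show "summable (\<lambda>m. cmod z ^ m)" using assms(2) by (simp add: summable_geometric)
  show "norm (c m * z ^ m) \<le> cmod z ^ m" for m
    using mult_right_mono[OF assms(1)[of m], of "cmod z ^ m"] by (simp add: norm_mult norm_power)
qed

lemma pseries_sums:
  assumes "\<And>m. norm (c m) \<le> 1" "cmod z < 1"
  shows "(\<lambda>m. c m * z ^ m) sums pseries c z"
  unfolding pseries_def by (rule summable_sums[OF summable_bounded_coeffs[OF assms]])

lemma deriv_pseries_sums:
  assumes "\<And>m. norm (c m) \<le> 1" "cmod z < 1"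
  shows "(\<lambda>m. of_nat m * c m * z ^ m) sums (z * deriv (pseries c) z)"
proof -
  have sm: "summable (\<lambda>n. c n * z ^ n)" if "norm z < 1" for z
    by (rule summable_bounded_coeffs[OF assms(1) that])
  have "(pseries c has_field_derivative (\<Sum>n. diffs c n * z ^ n)) (at z)"
    unfolding pseries_def by (rule termdiffs_strong'[OF sm assms(2)])
  then have "(\<lambda>n. diffs c n * z ^ n) sums deriv (pseries c) z"
    using termdiff_converges[OF assms(2) sm] by (simp add: DERIV_imp_deriv summable_sums)
  from sums_mult[OF this, of z]
  have "(\<lambda>n. of_nat (Suc n) * c (Suc n) * z ^ Suc n) sums (z * deriv (pseries c) z)"
    by (simp add: diffs_def mult_ac)
  \<comment> \<open>The factor \<open>of_nat m\<close> vanishes at \<open>m = 0\<close>, so the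
    index shift adds no term.\<close>
  then show ?thesis by (subst (asm) sums_Suc_iff) simp
qed

lemma rn_pseries_sums:
  assumes "\<And>m. norm (c m) \<le> 1" "0 < x" "x < 1" "n \<ge> 2" "x\<^sup>2 / (1 - x)\<^sup>2 \<le> real n + 1" "cmod z \<le> x"
  shows "(\<lambda>m. c m * (rn_coeff n m * z ^ m)) sums rn n (pseries c) z"
proof -
  have "(\<lambda>m. of_nat m * c m * z ^ m - (\<Sum>\<alpha>\<in>bessel_zeros n. c m * ((1 - \<alpha> / 2) * z) ^ m - c m * ((1 + \<alpha> / 2) * z) ^ m))
    sums rn n (pseries c) z"
    unfolding rn_def
    using assms norm_shifted_zero_less[OF _ assms(2-6)]
    by (intro sums_diff sums_sum deriv_pseries_sums pseries_sums) auto
  also have "(\<lambda>m. of_nat m * c m * z ^ m - (\<Sum>\<alpha>\<in>bessel_zeros n. c m * ((1 - \<alpha> / 2) * z) ^ m - c m * ((1 + \<alpha> / 2) * z) ^ m))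
    = (\<lambda>m. c m * (rn_coeff n m * z ^ m))"
    unfolding rn_coeff_def power_mult_distrib
    by (simp only: left_diff_distrib right_diff_distrib sum_distrib_left sum_distrib_right
        mult.left_commute[of "of_nat _" "c _"] mult.assoc)
  finally show ?thesis .
qed

text \<open>The geometric series starts at index 0, but the two powers of exponent 0 cancel in each
  difference, so the coefficients are those of \<open>rn_coeff\<close>.\<close>

lemma rn_geo_sums:
  assumes "0 < x" "x < 1" "n \<ge> 2" "x\<^sup>2 / (1 - x)\<^sup>2 \<le> real n + 1" "cmod z \<le> x"
  shows "(\<lambda>m. rn_coeff n m * z ^ m) sums rn_geo n z"
proof -
  have z: "cmod z < 1" using assms by simp
  have "(\<lambda>m. of_nat (Suc m) * z ^ Suc m) sums (z / (1 - z)\<^sup>2)"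
    using sums_mult[OF geometric_deriv_sums[OF z], of z] by (simp add: mult_ac)
  then have d: "(\<lambda>m. of_nat m * z ^ m) sums (z / (1 - z)\<^sup>2)"
    by (subst (asm) sums_Suc_iff) simp
  have "(\<lambda>m. of_nat m * z ^ m - (\<Sum>\<alpha>\<in>bessel_zeros n. ((1 - \<alpha> / 2) * z) ^ m - ((1 + \<alpha> / 2) * z) ^ m))
    sums rn_geo n z"
    unfolding rn_geo_def
    using norm_shifted_zero_less[OF _ assms]
    by (intro sums_diff sums_sum d geometric_sums) auto
  also have "(\<lambda>m. of_nat m * z ^ m - (\<Sum>\<alpha>\<in>bessel_zeros n. ((1 - \<alpha> / 2) * z) ^ m - ((1 + \<alpha> / 2) * z) ^ m))
    = (\<lambda>m. rn_coeff n m * z ^ m)"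
    unfolding rn_coeff_def power_mult_distrib
    by (simp only: left_diff_distrib sum_distrib_right)
  finally show ?thesis .
qed

section \<open>Coefficient bounds by Cauchy's inequality\<close>

lemma powser_sums_0_imp_coeff_0:
  fixes a :: "nat \<Rightarrow> complex"
  assumes "0 < r" and sums: "\<And>z. norm z < r \<Longrightarrow> (\<lambda>n. a n * z ^ n) sums 0"
  shows "a m = 0"
proof (rule ccontr)
  assume m: "a m \<noteq> 0"
  show False
  \<comment> \<open>The constant term is the value at 0. A nonzero coefficient of positive index
    would make 0 an isolated zero of the sum, which is identically zero.\<close>
  proof (cases "m = 0")
    case True
    then show False using sums[of 0] \<open>0 < r\<close> m by simp
  next
    case False
    show False
    proof (rule powser_0_nonzero[of r 0 a "\<lambda>_. 0" m])
      fix s :: real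
      assume s: "0 < s" "\<And>z :: complex. z \<in> cball 0 s - {0} \<Longrightarrow> (0 :: complex) \<noteq> 0"
      show False using s(2)[of "of_real s"] s(1) by simp
    qed (use assms m False in auto)
  qed
qed

text \<open>The closed form shows that the generating function of \<open>rn_coeff n\<close> is
  \<open>z^(2n+1) H(z)\<close> with \<open>H\<close> holomorphic on the closed disc of radius
  \<open>x\<close> and bounded there by \<open>B\<close>. Cauchy's inequality for \<open>H\<close>
  and uniqueness of coefficients give both claims.\<close>

lemma norm_rn_coeff_bound:
  assumes x: "0 < x" "x < 1" and n: "n \<ge> 2" and xn: "x\<^sup>2 / (1 - x)\<^sup>2 \<le> real n + 1"
  defines "B \<equiv> 2 / (1 - x) ^ (2 * n + 2) * ((fact n)\<^sup>2 / (fact (2 * n))\<^sup>2)"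
  shows "m < 2 * n + 1 \<Longrightarrow> rn_coeff n m = 0"
    and "cmod (rn_coeff n (k + (2 * n + 1))) \<le> B / x ^ k"
proof -
  define H where "H z = (-1) ^ n / (4 ^ n * (1 - z) ^ (2 * n + 2) * poly (bessel_q n) (z / (1 - z) / 2))" for z
  have nz: "z \<noteq> 1" "poly (bessel_q n) (z / (1 - z) / 2) \<noteq> 0" if "cmod z \<le> x" for z
    using that x norm_mobius_le[OF x xn that] poly_bessel_q_nonzero[OF n] by auto
  have hol: "H holomorphic_on cball 0 x"
    unfolding H_def poly_altdef using nz
    by (intro holomorphic_intros) (auto simp: poly_altdef)
  then have hol': "H holomorphic_on ball 0 x" by (rule holomorphic_on_subset) auto
  define h where "h m = (deriv ^^ m) H 0 / fact m" for m
  have H_sums: "(\<lambda>m. h m * z ^ m) sums H z" if "cmod z < x" for z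
    using holomorphic_power_series[OF hol', of z] that by (simp add: h_def)
  have bound: "cmod (H z) \<le> B" if "cmod z \<le> x" for z
  proof -
    define D where "D = cmod (coeff (bessel_q n) 0)"
    have D: "D > 0" by (simp add: D_def norm_coeff_bessel_q_0)
    have "1 - x \<le> cmod (1 - z)" using norm_triangle_ineq2[of 1 z] that by simp
    then have "(1 - x) ^ (2 * n + 2) \<le> cmod (1 - z) ^ (2 * n + 2)" using x by (intro power_mono) auto
    moreover have "D / 2 \<le> cmod (poly (bessel_q n) (z / (1 - z) / 2))"
      unfolding D_def by (rule norm_bessel_q_ge[OF n norm_mobius_le[OF x xn that]])
    \<comment> \<open>The halved value \<open>D / 2\<close> is the source of the factor 2 in
      \<open>B\<close>.\<close>
    ultimately have "4 ^ n * (1 - x) ^ (2 * n + 2) * (D / 2)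
        \<le> 4 ^ n * cmod (1 - z) ^ (2 * n + 2) * cmod (poly (bessel_q n) (z / (1 - z) / 2))"
      using D x by (intro mult_mono) auto
    then have "1 / (4 ^ n * cmod (1 - z) ^ (2 * n + 2) * cmod (poly (bessel_q n) (z / (1 - z) / 2)))
        \<le> 1 / (4 ^ n * (1 - x) ^ (2 * n + 2) * (D / 2))"
      using D x by (intro frac_le) auto
    also have "\<dots> = 2 / (1 - x) ^ (2 * n + 2) * (1 / (4 ^ n * D))" by simp
    also have "\<dots> = B" unfolding D_def norm_coeff_bessel_q_0_inverse B_def ..
    finally show ?thesis by (simp only: H_def norm_divide norm_mult norm_power norm_minus_cancel norm_one power_one norm_numeral)
  qed
  have h: "cmod (h k) \<le> B / x ^ k" for k
  proof -
    have "cmod ((deriv ^^ k) H 0) \<le> fact k * B / x ^ k"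
      by (rule Cauchy_inequality)
        (use hol hol' x bound in \<open>auto intro: holomorphic_on_imp_continuous_on\<close>)
    then show ?thesis by (simp add: h_def norm_divide pos_divide_le_eq mult_ac)
  qed
  \<comment> \<open>The Taylor coefficients of \<open>z^(2n+1) H(z)\<close>, to be identified with
    \<open>rn_coeff n\<close>.\<close>
  define e where "e m = (if m < 2 * n + 1 then 0 else h (m - (2 * n + 1)))" for m
  have "rn_coeff n m - e m = 0" for m
  proof (rule powser_sums_0_imp_coeff_0[OF x(1)])
    fix z assume z: "cmod z < x"
    have "(\<lambda>m. h m * z ^ m * z ^ (2 * n + 1)) sums (H z * z ^ (2 * n + 1))"
      by (rule sums_mult2[OF H_sums[OF z]])
    then have "(\<lambda>m. e (m + (2 * n + 1)) * z ^ (m + (2 * n + 1))) sums (H z * z ^ (2 * n + 1))"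
      by (simp add: e_def power_add mult_ac)
    then have "(\<lambda>m. e m * z ^ m) sums (H z * z ^ (2 * n + 1) + (\<Sum>i<2 * n + 1. e i * z ^ i))"
      by (rule sums_iff_shift[of "\<lambda>m. e m * z ^ m", THEN iffD1])
    also have "(\<Sum>i<2 * n + 1. e i * z ^ i) = 0" by (rule sum.neutral) (simp add: e_def)
    also have "H z * z ^ (2 * n + 1) + 0 = rn_geo n z"
      unfolding H_def using rn_geo_eq[of n z] nz[of z] n z by simp
    finally have "(\<lambda>m. e m * z ^ m) sums rn_geo n z" .
    from sums_diff[OF rn_geo_sums[OF x n xn less_imp_le[OF z]] this]
    show "(\<lambda>m. (rn_coeff n m - e m) * z ^ m) sums 0" by (simp add: left_diff_distrib)
  qed
  then have e: "rn_coeff n m = e m" for m by simp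
  show "m < 2 * n + 1 \<Longrightarrow> rn_coeff n m = 0" by (simp add: e e_def)
  show "cmod (rn_coeff n (k + (2 * n + 1))) \<le> B / x ^ k" using h by (simp add: e e_def)
qed

text \<open>The terms before index \<open>2n+1\<close> vanish and the others are dominated by a
  geometric series of ratio \<open>|z|/x\<close>, whose sum yields
  \<open>x / (x - |z|)\<close>.\<close>

lemma rn_pseries_bound:
  assumes "\<And>m. norm (c m) \<le> 1" and x: "0 < x" "x < 1" and n: "n \<ge> 2"
    and xn: "x\<^sup>2 / (1 - x)\<^sup>2 \<le> real n + 1" and z: "cmod z < x"
  shows "cmod (rn n (pseries c) z)
        \<le> norm z ^ (2*n+1) / (x - norm z) * (2 * x / (1 - x) ^ (2*n+2)
           * ((fact n)\<^sup>2 / (fact (2*n))\<^sup>2))"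
proof -
  define B where "B = 2 / (1 - x) ^ (2 * n + 2) * ((fact n)\<^sup>2 / (fact (2 * n))\<^sup>2)"
  note coeffs = norm_rn_coeff_bound[OF x n xn, folded B_def]
  let ?f = "\<lambda>m. c m * (rn_coeff n m * z ^ m)"
  have "?f sums rn n (pseries c) z"
    using rn_pseries_sums[OF assms(1) x n xn] z by simp
  then have "?f sums (rn n (pseries c) z + (\<Sum>i<2 * n + 1. ?f i))"
    by (subst sum.neutral) (auto simp: coeffs(1))
  then have "(\<lambda>k. ?f (k + (2 * n + 1))) sums rn n (pseries c) z"
    by (rule sums_iff_shift[of ?f, THEN iffD2])
  then have "rn n (pseries c) z = (\<Sum>k. ?f (k + (2 * n + 1)))" by (rule sums_unique)
  also have "cmod \<dots> \<le> (\<Sum>k. B * cmod z ^ (2 * n + 1) * (cmod z / x) ^ k)"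
  proof (rule norm_suminf_le)
    fix k
    have "norm (?f (k + (2 * n + 1)))
        = cmod (c (k + (2 * n + 1))) * (cmod (rn_coeff n (k + (2 * n + 1))) * cmod z ^ (k + (2 * n + 1)))"
      by (simp only: norm_mult norm_power)
    also have "\<dots> \<le> 1 * (B / x ^ k * cmod z ^ (k + (2 * n + 1)))"
      using assms(1) by (intro mult_mono coeffs(2) mult_nonneg_nonneg order_trans[OF norm_ge_zero coeffs(2)]) auto
    also have "\<dots> = B * cmod z ^ (2 * n + 1) * (cmod z / x) ^ k"
      by (simp add: power_add power_divide)
    finally show "norm (?f (k + (2 * n + 1))) \<le> B * cmod z ^ (2 * n + 1) * (cmod z / x) ^ k" .
  qed (use z x in \<open>auto intro!: summable_mult summable_geometric\<close>)
  also have "\<dots> = B * cmod z ^ (2 * n + 1) * (1 / (1 - cmod z / x))"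
    using z x by (subst suminf_mult) (auto simp: suminf_geometric intro!: summable_geometric)
  also have "1 / (1 - cmod z / x) = x / (x - cmod z)" using z x by (simp add: field_simps)
  finally show ?thesis by (simp add: B_def mult_ac)
qed

text \<open>At \<open>z = x\<close> the variable \<open>s\<close> is real, so
  \<open>|q(s)| <= q(0)\<close> applies in the denominator of the closed form.\<close>

lemma rn_geometric_lower_bound:
  assumes x: "0 < x" "x < 1" and n: "n \<ge> 2" and xn: "x\<^sup>2 / (1 - x)\<^sup>2 \<le> real n + 1"
  shows "x ^ (2*n+1) / (1 - x) ^ (2*n+2) * ((fact n)\<^sup>2 / (fact (2*n))\<^sup>2)
    \<le> cmod (rn n (\<lambda>w. w / (1 - w)) (of_real x))"
proof -
  let ?s = "x / (1 - x) / 2" and ?D = "cmod (coeff (bessel_q n) 0)"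
  have "?s\<^sup>2 = x\<^sup>2 / (1 - x)\<^sup>2 / 4" by (simp only: power_divide) simp
  also have "\<dots> \<le> (real n + 1) / 4" using xn by (rule divide_right_mono) simp
  finally have s: "?s\<^sup>2 \<le> (real n + 1) / 4" .
  have sx: "of_real x / (1 - of_real x) / 2 = complex_of_real ?s" by simp
  let ?q = "cmod (poly (bessel_q n) (of_real ?s))"
  have "cmod (of_real ?s) ^ 2 \<le> (real n + 1) / 4" using s by (simp only: norm_of_real power2_abs)
  then have q: "poly (bessel_q n) (of_real ?s) \<noteq> 0" by (rule poly_bessel_q_nonzero[OF n])
  have x1: "cmod (1 - of_real x) = 1 - x"
    using x norm_of_real[of "1 - x", where 'a = complex] by simp
  have "x ^ (2*n+1) / (1 - x) ^ (2*n+2) * (1 / (4 ^ n * ?D))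
      \<le> x ^ (2*n+1) / (1 - x) ^ (2*n+2) * (1 / (4 ^ n * ?q))"
    using x norm_bessel_q_of_real_le[OF n s] q by (intro mult_left_mono frac_le mult_pos_pos) auto
  also have "\<dots> = cmod (rn_geo n (of_real x))"
    using rn_geo_eq[of n "of_real x"] q n x unfolding sx
    by (simp add: norm_mult norm_divide norm_power x1)
  also have "rn_geo n (of_real x) = rn n (\<lambda>w. w / (1 - w)) (of_real x)"
    using rn_geometric[of n "of_real x"] q n x unfolding sx by simp
  finally show ?thesis unfolding norm_coeff_bessel_q_0_inverse .
qed

subsection \<open>The case of the square root\<close>

lemma one_plus_inverse_power_le:
  assumes "n \<ge> 1"
  shows "(1 + 1 / real n) ^ n \<le> 2.72"
proof -
  have "(1 + 1 / real n) ^ n \<le> exp (1 / real n) ^ n"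
    by (intro power_mono exp_ge_add_one_self) simp
  also have "\<dots> = exp 1" using assms by (simp flip: exp_of_nat_mult)
  also have "\<dots> \<le> 2.72" using e_less_272 by simp
  finally show ?thesis .
qed

text \<open>The squared quantity \<open>E n\<close> decreases from \<open>n = 13\<close> on: its
  quotient \<open>E (n+1) / E n\<close> is \<open>(1 + 1/n)^n (n+1) / (2(2n+1))\<close> times
  \<open>1.2774 / 0.92\<close>, which is below 1 because \<open>(1 + 1/n)^n <= 2.72\<close>. A
  numerical check at 13 finishes.\<close>

lemma fact_ratio_bound:
  assumes "n \<ge> 13"
  shows "2 * 1.2774 * (fact n / fact (2 * n) * real n ^ n * (1.2774 / 0.92) ^ n)\<^sup>2 \<le> (1 :: real)"
proof -
  define E where "E n = fact n / fact (2 * n) * real n ^ n * (1.2774 / 0.92) ^ n" for n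
  have mono: "E (Suc n) \<le> E n" if "n \<ge> 13" for n
  proof -
    define t where "t = (1 + 1 / real n) ^ n"
    have t: "0 \<le> t" "t \<le> 2.72" using one_plus_inverse_power_le[of n] that by (auto simp: t_def)
    have n: "real n > 0" using that by simp
    have "real (Suc n) ^ n = t * real n ^ n"
      using n by (simp add: t_def field_simps flip: power_mult_distrib)
    moreover have "(fact (2 * Suc n) :: real) = real (2 * n + 2) * real (2 * n + 1) * fact (2 * n)"
      by (simp add: algebra_simps)
    moreover have "(fact (Suc n) :: real) = real (n + 1) * fact n" by simp
    ultimately have "E (Suc n) = (real (n + 1) / (real (2 * n + 2) * real (2 * n + 1)) * real (Suc n) * t * (1.2774 / 0.92)) * E n"
      unfolding E_def by (simp only: power_Suc) (simp add: mult_ac)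
    also have "real (n + 1) / (real (2 * n + 2) * real (2 * n + 1)) * real (Suc n) * t * (1.2774 / 0.92) \<le> 1"
    proof -
      have "real (n + 1) / (real (2 * n + 2) * real (2 * n + 1)) * real (Suc n)
        = (real n + 1) / (2 * (2 * real n + 1))"
        by (simp add: divide_simps) (simp add: algebra_simps)
      \<comment> \<open>The fraction decreases in \<open>n\<close>; this is its value at 13.\<close>
      also have "\<dots> \<le> 14 / 54" using that by (simp add: divide_simps)
      finally have "real (n + 1) / (real (2 * n + 2) * real (2 * n + 1)) * real (Suc n) * t \<le> 14 / 54 * 2.72"
        using t by (intro mult_mono) auto
      then have "real (n + 1) / (real (2 * n + 2) * real (2 * n + 1)) * real (Suc n) * t * (1.2774 / 0.92)
          \<le> 14 / 54 * 2.72 * (1.2774 / 0.92)"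
        by (rule mult_right_mono) simp
      also have "\<dots> \<le> 1" by simp
      finally show ?thesis .
    qed
    then have "(real (n + 1) / (real (2 * n + 2) * real (2 * n + 1)) * real (Suc n) * t * (1.2774 / 0.92)) * E n \<le> 1 * E n"
      by (rule mult_right_mono) (simp add: E_def)
    finally show ?thesis by simp
  qed
  have "E n \<le> E 13"
    using assms by (induction rule: dec_induct) (use mono order_trans in blast)+
  \<comment> \<open>Any bound whose square times \<open>2 * 1.2774\<close> stays below 1 would
    do.\<close>
  also have "\<dots> \<le> 0.6"
    unfolding E_def by (simp add: fact_numeral power_divide)
  finally have "(E n)\<^sup>2 \<le> 0.6\<^sup>2"
    by (rule power_mono) (simp add: E_def)
  then have "2 * 1.2774 * (E n)\<^sup>2 \<le> 1" by (simp add: power2_eq_square)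
  then show ?thesis unfolding E_def .
qed

text \<open>With \<open>r = sqrt n\<close> and \<open>u = 1 + 1/r\<close> the factor depending on
  \<open>x\<close> becomes \<open>2 n^(n+1) u^(2n+1)\<close>; the factorials absorb its growth by
  the preceding estimate.\<close>

lemma bound_at_sqrt:
  fixes n :: nat
  assumes "n \<ge> 13"
  defines "x \<equiv> sqrt n / (1 + sqrt n)"
  shows "2 * x / (1 - x) ^ (2 * n + 2) * ((fact n)\<^sup>2 / (fact (2 * n))\<^sup>2)
    \<le> 0.92 ^ (2 * n) / real n ^ (n - 1)"
proof -
  define r where "r = sqrt n"
  define u where "u = 1 + 1 / r"
  have r: "r > 0" "r\<^sup>2 = real n" using assms by (simp_all add: r_def)
  \<comment> \<open>A decimal lower bound for \<open>sqrt 13\<close>, giving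
    \<open>u <= 1.2774\<close>.\<close>
  have "3.6055 \<le> r" unfolding r_def by (rule real_le_rsqrt) (use assms(1) in \<open>simp add: power2_eq_square\<close>)
  then have u: "u \<le> 1.2774" "u > 0" using r by (simp_all add: u_def divide_simps add_pos_pos)
  have x: "1 - x = 1 / (1 + r)" "x = r / (1 + r)"
    using r by (simp_all add: x_def r_def[symmetric] field_simps)
  have ru: "1 + r = r * u" using r by (simp add: u_def field_simps)
  have "2 * x / (1 - x) ^ (2 * n + 2) = 2 * r * (1 + r) ^ (2 * n + 1)"
    using r unfolding x(1) unfolding x(2) by (simp add: power_divide)
  also have "\<dots> = 2 * (r\<^sup>2) ^ (n + 1) * u ^ (2 * n + 1)"
  proof -
    have "(r\<^sup>2) ^ (n + 1) = r ^ (2 * (n + 1))" by (simp only: power_mult)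
    then show ?thesis unfolding ru power_mult_distrib by simp
  qed
  \<comment> \<open>Here \<open>n^(n+1) = n^(2n) / n^(n-1)\<close>, which produces the denominator
    of the claim.\<close>
  also have "\<dots> = 2 * (real n ^ n)\<^sup>2 * u ^ (2 * n + 1) / real n ^ (n - 1)"
  proof -
    obtain d where "n = Suc d" using assms by (cases n) auto
    then show ?thesis unfolding r by (simp add: power2_eq_square field_simps)
  qed
  finally have "2 * x / (1 - x) ^ (2 * n + 2) * ((fact n)\<^sup>2 / (fact (2 * n))\<^sup>2)
    = 2 * (real n ^ n)\<^sup>2 * u ^ (2 * n + 1) / real n ^ (n - 1) * ((fact n)\<^sup>2 / (fact (2 * n))\<^sup>2)"
    by (rule arg_cong)
  also have "\<dots> = 2 * (fact n / fact (2 * n) * real n ^ n)\<^sup>2 * u ^ (2 * n + 1) / real n ^ (n - 1)"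
  proof -
    have "2 * N\<^sup>2 * U / P * (F\<^sup>2 / G\<^sup>2) = 2 * (F / G * N)\<^sup>2 * U / P" for N U P F G :: real
      by (simp add: power2_eq_square mult_ac)
    then show ?thesis .
  qed
  also have "\<dots> \<le> 2 * (fact n / fact (2 * n) * real n ^ n)\<^sup>2 * 1.2774 ^ (2 * n + 1) / real n ^ (n - 1)"
    using u by (intro divide_right_mono mult_left_mono power_mono) auto
  also have "\<dots> = (2 * 1.2774 * (fact n / fact (2 * n) * real n ^ n * (1.2774 / 0.92) ^ n)\<^sup>2)
      * 0.92 ^ (2 * n) / real n ^ (n - 1)"
  proof -
    have "(c / d) ^ (2 * n) * d ^ (2 * n) = c ^ (2 * n)" if "d \<noteq> 0" for c d :: real
      using that by (simp add: power_divide)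
    from this[of "0.92" "1.2774"]
    have "1.2774 ^ (2 * n + 1) = 1.2774 * (((1.2774 / 0.92) ^ n)\<^sup>2 * 0.92 ^ (2 * n) :: real)"
      by (simp only: power_mult[symmetric] mult.commute[of n 2] power_add power_one_right) simp
    moreover have "2 * Q\<^sup>2 * (c * (w\<^sup>2 * d)) / P = (2 * c * (Q * w)\<^sup>2) * d / P" for Q c w d P :: real
      by (simp add: power2_eq_square)
    ultimately show ?thesis by (simp only:)
  qed
  also have "\<dots> \<le> 1 * 0.92 ^ (2 * n) / real n ^ (n - 1)"
    using fact_ratio_bound[OF assms(1)] by (intro divide_right_mono mult_right_mono) auto
  finally show ?thesis by simp
qed

theorem theorem1:
  shows
  "(\<forall>(x::real) (c::nat \<Rightarrow> complex) (n::nat) (z::complex).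
      0 < x \<and> x < 1 \<and> (\<forall>m. norm (c m) \<le> 1) \<and> real n \<ge> n0 x \<and> norm z < x \<longrightarrow>
      norm (rn n (pseries c) z)
        \<le> norm z ^ (2*n+1) / (x - norm z) * (2 * x / (1 - x) ^ (2*n+2))
           * ((fact n)\<^sup>2 / (fact (2*n))\<^sup>2))
   \<and> (\<forall>(x::real) (n::nat).
      0 < x \<and> x < 1 \<and> real n \<ge> n0 x \<longrightarrow>
      (\<exists>z::complex. norm z = x \<and>
         norm (rn n (\<lambda>w. w / (1 - w)) z)
           \<ge> x ^ (2*n+1) / (1 - x) ^ (2*n+2) * ((fact n)\<^sup>2 / (fact (2*n))\<^sup>2)))
   \<and> (\<forall>(c::nat \<Rightarrow> complex) (n::nat) (z::complex).
      (\<forall>m. norm (c m) \<le> 1) \<and> n \<ge> 13 \<and>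
      norm z < sqrt (real n) / (1 + sqrt (real n)) \<longrightarrow>
      norm (rn n (pseries c) z)
        \<le> norm z ^ (2*n+1) / (sqrt (real n) / (1 + sqrt (real n)) - norm z)
           * (0.92 ^ (2*n) / real n ^ (n - 1)))"
proof (intro conjI allI impI; elim conjE)
  \<comment> \<open>The subtracted 1 in \<open>n0\<close> becomes the \<open>+ 1\<close> on the
    right side.\<close>
  have n0: "n \<ge> 2" "x\<^sup>2 / (1 - x)\<^sup>2 \<le> real n + 1" if "n0 x \<le> real n" for n x
    using that by (auto simp: n0_def)
  fix x :: real and n :: nat
  assume x: "0 < x" "x < 1" and n: "n0 x \<le> real n"
  {
    fix c :: "nat \<Rightarrow> complex" and z :: complex
    assume "\<forall>m. norm (c m) \<le> 1" "norm z < x"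
    then show "norm (rn n (pseries c) z)
        \<le> norm z ^ (2*n+1) / (x - norm z) * (2 * x / (1 - x) ^ (2*n+2))
           * ((fact n)\<^sup>2 / (fact (2*n))\<^sup>2)"
      using rn_pseries_bound[OF _ x n0[OF n], of c z] by (simp only: mult.assoc)
  }
  show "\<exists>z::complex. norm z = x \<and>
         norm (rn n (\<lambda>w. w / (1 - w)) z)
           \<ge> x ^ (2*n+1) / (1 - x) ^ (2*n+2) * ((fact n)\<^sup>2 / (fact (2*n))\<^sup>2)"
    \<comment> \<open>The witness is the positive real point of the circle.\<close>
    using rn_geometric_lower_bound[OF x n0[OF n]] x by (intro exI[of _ "of_real x"]) simp
next
  fix c :: "nat \<Rightarrow> complex" and n :: nat and z :: complex
  assume c: "\<forall>m. norm (c m) \<le> 1" and n: "13 \<le> n"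
    and z: "norm z < sqrt (real n) / (1 + sqrt (real n))"
  define x where "x = sqrt (real n) / (1 + sqrt (real n))"
  have s: "sqrt (real n) > 0" using n by simp
  have x: "0 < x" "x < 1" using s by (simp_all add: x_def add_pos_pos)
  have ne: "1 + sqrt (real n) \<noteq> 0" using s by linarith
  then have "1 - x = 1 / (1 + sqrt (real n))" by (simp add: x_def field_simps)
  then have "x / (1 - x) = sqrt (real n)" using ne by (simp add: x_def)
  \<comment> \<open>The choice of \<open>x\<close> makes this quotient exactly \<open>n\<close>, so
    the condition with \<open>n + 1\<close> holds.\<close>
  then have "x\<^sup>2 / (1 - x)\<^sup>2 = real n" by (metis power_divide real_sqrt_pow2 of_nat_0_le_iff)
  then have "norm (rn n (pseries c) z)
        \<le> norm z ^ (2*n+1) / (x - norm z) * (2 * x / (1 - x) ^ (2*n+2)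
           * ((fact n)\<^sup>2 / (fact (2*n))\<^sup>2))"
    using rn_pseries_bound[OF _ x, of c n z] c n z by (simp add: x_def)
  also have "\<dots> \<le> norm z ^ (2*n+1) / (x - norm z) * (0.92 ^ (2*n) / real n ^ (n - 1))"
    using bound_at_sqrt[OF n] z by (intro mult_left_mono) (simp_all add: x_def)
  finally show "norm (rn n (pseries c) z)
        \<le> norm z ^ (2*n+1) / (sqrt (real n) / (1 + sqrt (real n)) - norm z)
           * (0.92 ^ (2*n) / real n ^ (n - 1))" unfolding x_def .
qed

end
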